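(* For every real $R>0$, one has $A_{\mathrm{gen}}(R)=+\infty$, where $$A_{\mathrm{gen}}(R):=\sup\left\{Q(D_1,D_2;z): D_1,D_2\in\mathcal H_R,\ z\in D_1\cap D_2\right\},\qquad Q(D_1,D_2;z):=\frac{\lambda_{D_1\cap D_2}(z)}{\lambda_{D_1}(z)+\lambda_{D_2}(z)},$$ and $\mathcal H_R$ is the class of hyperbolic domains in $\mathbb C$ contained in $\{z\in\mathbb C:|z|<R\}$.
   Context: A domain is a nonempty connected open set. A domain $G\subset\mathbb C$ is hyperbolic if $\mathbb C\setminus G$ contains at least two points (so every domain contained in $\mathbb D_R:=\{z\in\mathbb C:|z|<R\}$ is hyperbolic). For a hyperbolic domain $G$, $\lambda_G$ denotes the density of its hyperbolic metric $\lambda_G(z)\,|dz|$, normalized by $\lambda_{\mathbb D}(z)=\frac{1}{1-|z|^2}$ on the unit disk $\mathbb D$; equivalently, $\lambda_G$ is the unique function with $\lambda_G(\pi(\zeta))\,|\pi'(\zeta)|=\lambda_{\mathbb D}(\zeta)$ for all $\zeta\in\mathbb D$, for a holomorphic universal covering map $\pi:\mathbb D\to G$. Convention: if $D_1\cap D_2$ is not connected and $z\in D_1\cap D_2$, then $\lambda_{D_1\cap D_2}(z)$ means the hyperbolic density at $z$ of the connected component of $D_1\cap D_2$ containing $z$. *)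

theory Defs
  imports "HOL-Complex_Analysis.Complex_Analysis"
begin

definition hyperbolic_domain :: "complex set \<Rightarrow> bool" where
  "hyperbolic_domain G \<longleftrightarrow>
     G \<noteq> {} \<and> open G \<and> connected G \<and> (\<exists>a b. a \<noteq> b \<and> a \<notin> G \<and> b \<notin> G)"

(* Since the unit disk is simply connected, every covering with it as total space is universal.
   Surjectivity onto G is part of covering_space. *)
definition holomorphic_universal_covering :: "(complex \<Rightarrow> complex) \<Rightarrow> complex set \<Rightarrow> bool" where
  "holomorphic_universal_covering p G \<longleftrightarrow>
     p holomorphic_on ball 0 1 \<and> covering_space (ball 0 1) p G"

definition disk_density :: "complex \<Rightarrow> real" where
  "disk_density \<zeta> = 1 / (1 - (cmod \<zeta>)\<^sup>2)"

(* Meaningful only for a hyperbolic domain G and z in G; curvature -4 normalization. *)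
definition hyperbolic_density :: "complex set \<Rightarrow> complex \<Rightarrow> real" where
  "hyperbolic_density G z =
     (THE r. \<exists>p. holomorphic_universal_covering p G \<and>
                 (\<forall>\<zeta>\<in>ball 0 1. p \<zeta> = z \<longrightarrow> r * cmod (deriv p \<zeta>) = disk_density \<zeta>))"

(* The intersection of two domains may be disconnected, so its density at z is that of the
   component containing z (which is the whole intersection if that is connected). *)
definition Q :: "complex set \<Rightarrow> complex set \<Rightarrow> complex \<Rightarrow> real" where
  "Q D1 D2 z =
     hyperbolic_density (connected_component_set (D1 \<inter> D2) z) z /
       (hyperbolic_density D1 z + hyperbolic_density D2 z)"

definition hyperbolic_domains_in :: "real \<Rightarrow> complex set set" where
  "hyperbolic_domains_in R = {G. hyperbolic_domain G \<and> G \<subseteq> {z. cmod z < R}}"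

definition A_gen :: "real \<Rightarrow> ereal" where
  "A_gen R = Sup {ereal (Q D1 D2 z) | D1 D2 z.
     D1 \<in> hyperbolic_domains_in R \<and> D2 \<in> hyperbolic_domains_in R \<and> z \<in> D1 \<inter> D2}"

end

(*
  Delete one point from the disk to get D1 and another one, at distance 2d, to get D2; let z be their
  midpoint. Near an isolated boundary point at distance d the hyperbolic density is of order
  1 / (d log(1/d)), whereas the intersection omits two points at distance d from z, so by
  Landau's theorem its density at z is at least C / d. Hence Q grows like log(1/d).

  The densities are only meaningful once universal coverings exist. For a bounded domain G
  consider holomorphic coverings q of G by open subsets U of the unit disk, with q(0) fixed, and
  minimise |q'(0)|, which is bounded below by the Schwarz lemma. If U omits a point a of the disk, Koebe's
  square root step multiplies |q'(0)| by 2 sqrt|a| / (1 + |a|) < 1; so along a minimising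
  sequence the sets U exhaust the disk, and a Montel limit covers G by the whole disk.
*)
theory Submission
  imports Defs "HOL-Real_Asymp.Real_Asymp"
begin

subsection \<open>Hyperbolic density from a covering\<close>

text \<open>In the quotient rule the numerator collapses to 1 - |w|^2. At \<open>z = w\<close> the
  derivative becomes the disk density of \<open>w\<close>, at \<open>z = 0\<close> its reciprocal;
  later steps use just these two cases.\<close>

lemma Moebius_function_has_derivative:
  assumes "norm w < 1" "norm z < 1"
  shows "(Moebius_function 0 w has_field_derivative (1 - of_real ((cmod w)\<^sup>2)) / (1 - cnj w * z)\<^sup>2) (at z)"
proof -
  have "norm (cnj w * z) < 1"
    using norm_mult_less[of "cnj w" 1 z 1] assms by simp
  then have "cnj w * z \<noteq> 1"
    by (rule contrapos_pn) (simp only: norm_one less_irrefl not_False_eq_True)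
  then have nz: "1 - cnj w * z \<noteq> 0"
    unfolding right_minus_eq by (rule not_sym)
  have eq: "((1 - cnj w * z) - (z - w) * (- cnj w)) = 1 - of_real ((cmod w)\<^sup>2)"
    by (simp add: algebra_simps flip: complex_norm_square)
  have "((\<lambda>z. z - w) has_field_derivative 1) (at z)"
    "((\<lambda>z. 1 - cnj w * z) has_field_derivative - cnj w) (at z)"
    by (auto intro!: derivative_eq_intros)
  from DERIV_divide[OF this nz] show ?thesis
    unfolding mult_1 eq by (simp only: Moebius_function_simple[abs_def] power2_eq_square)
qed

text \<open>A covering map is locally injective, and an injective holomorphic map has no critical
  points. This permits division by \<open>cmod (deriv p \<zeta>)\<close> in the density
  formulas.\<close>

lemma universal_covering_deriv_nonzero:
  assumes cov: "holomorphic_universal_covering p G" and \<zeta>: "\<zeta> \<in> ball 0 1"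
  shows "deriv p \<zeta> \<noteq> 0"
proof -
  have hol: "p holomorphic_on ball 0 1" and cs: "covering_space (ball 0 1) p G"
    using cov by (auto simp: holomorphic_universal_covering_def)
  obtain T u q where "\<zeta> \<in> T" "openin (top_of_set (ball 0 1)) T"
      and "homeomorphism T u p q"
    using covering_space_local_homeomorphism[OF cs \<zeta>] by metis
  then have "open T" "T \<subseteq> ball 0 1" "inj_on p T"
    by (auto simp: openin_open_eq homeomorphism_def inj_on_def) metis
  then show ?thesis
    using holomorphic_injective_imp_regular[OF holomorphic_on_subset[OF hol]] \<open>\<zeta> \<in> T\<close> by blast
qed

lemma disk_density_pos: "\<zeta> \<in> ball 0 1 \<Longrightarrow> disk_density \<zeta> > 0"
  by (simp add: disk_density_def power_less_one_iff abs_square_less_1)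

text \<open>The Schwarz-Pick lemma seen through the covering: \<open>f\<close> lifts to a self-map
  \<open>g\<close> of the disk with \<open>g 0 = \<zeta>\<close>, and Schwarz's lemma applies to
  \<open>g\<close> followed by the automorphism that moves \<zeta> to 0.\<close>

lemma deriv_le_of_universal_covering:
  assumes cov: "holomorphic_universal_covering p G" and \<zeta>: "\<zeta> \<in> ball 0 1"
    and f: "f holomorphic_on ball 0 1" "f \<in> ball 0 1 \<rightarrow> G" "f 0 = p \<zeta>"
  shows "cmod (deriv f 0) * disk_density \<zeta> \<le> cmod (deriv p \<zeta>)"
proof -
  have hol: "p holomorphic_on ball 0 1" and cs: "covering_space (ball 0 1) p G"
    using cov by (auto simp: holomorphic_universal_covering_def)
  obtain g where g: "continuous_on (ball 0 1) g" "g \<in> ball 0 1 \<rightarrow> ball 0 1" "g 0 = \<zeta>"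
      and pg: "\<And>y. y \<in> ball 0 1 \<Longrightarrow> p (g y) = f y"
  proof (rule covering_space_lift_strong[OF cs \<zeta>, of 0 "ball 0 1" f])
    show "simply_connected (ball 0 1 :: complex set)"
      by (simp add: convex_imp_simply_connected)
    show "locally path_connected (ball 0 1 :: complex set)"
      by (simp add: open_imp_locally_path_connected)
  qed (use f in \<open>auto intro: holomorphic_on_imp_continuous_on\<close>)
  have holg: "g holomorphic_on ball 0 1"
    using covering_space_lift_is_holomorphic[OF cs _ hol f(1,2) g(2,1)] pg by auto
  have \<zeta>': "norm \<zeta> < 1" using \<zeta> by simp
  define M where "M = Moebius_function 0 \<zeta>"
  have norm_g: "norm z < 1 \<Longrightarrow> norm (g z) < 1" for z
    using g(2) by (force simp: Pi_iff)
  have "(M \<circ> g) holomorphic_on ball 0 1"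
    unfolding M_def
    by (rule holomorphic_on_compose_gen[OF holg Moebius_function_holomorphic[OF \<zeta>']])
       (use g in auto)
  then have le1: "norm (deriv (M \<circ> g) 0) \<le> 1"
    by (rule Schwarz_Lemma(2)[where \<xi> = 0])
       (use g(3) Moebius_function_norm_lt_1[OF \<zeta>' norm_g] in \<open>simp_all add: M_def Moebius_function_eq_zero\<close>)
  have dg: "(g has_field_derivative deriv g 0) (at 0)"
    using holg by (auto intro: holomorphic_derivI[where S = "ball 0 1"])
  have dM: "(M has_field_derivative of_real (disk_density \<zeta>)) (at \<zeta>)"
  proof -
    have "1 - cnj \<zeta> * \<zeta> = 1 - of_real ((cmod \<zeta>)\<^sup>2)"
      by (simp only: complex_norm_square mult.commute)
    moreover have "1 - complex_of_real ((cmod \<zeta>)\<^sup>2) \<noteq> 0"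
    proof -
      have "1 - (cmod \<zeta>)\<^sup>2 \<noteq> 0"
        using disk_density_pos[OF \<zeta>] by (auto simp: disk_density_def)
      then have "complex_of_real (1 - (cmod \<zeta>)\<^sup>2) \<noteq> 0"
        by (simp only: of_real_eq_0_iff not_False_eq_True)
      then show ?thesis by simp
    qed
    ultimately show ?thesis
      using Moebius_function_has_derivative[OF \<zeta>' \<zeta>']
      by (simp add: M_def disk_density_def power2_eq_square)
  qed
  have "(M \<circ> g has_field_derivative of_real (disk_density \<zeta>) * deriv g 0) (at 0)"
    by (rule DERIV_chain) (use dM dg g in simp_all)
  then have "deriv (M \<circ> g) 0 = of_real (disk_density \<zeta>) * deriv g 0"
    by (rule DERIV_imp_deriv)
  then have 1: "disk_density \<zeta> * norm (deriv g 0) \<le> 1"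
    using le1 disk_density_pos[OF \<zeta>] by (simp add: norm_mult)
  have "(p has_field_derivative deriv p \<zeta>) (at (g 0))"
    using hol \<zeta> g by (auto intro: holomorphic_derivI[where S = "ball 0 1"])
  then have "(p \<circ> g has_field_derivative deriv p \<zeta> * deriv g 0) (at 0)"
    using dg by (rule DERIV_chain)
  then have "(f has_field_derivative deriv p \<zeta> * deriv g 0) (at 0)"
    by (rule DERIV_cong_ev[THEN iffD1, rotated -1])
       (auto intro!: eventually_nhds_in_open[of "ball 0 1", THEN eventually_mono] pg)
  then have "deriv f 0 = deriv p \<zeta> * deriv g 0"
    by (rule DERIV_imp_deriv)
  then show ?thesis
    using mult_left_mono[OF 1, of "cmod (deriv p \<zeta>)"] by (simp add: norm_mult mult_ac)
qed

text \<open>Precomposed with the automorphism taking 0 to \<xi>, \<open>q\<close> becomes a test map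
  for the preceding derivative bound. Exchanging the two coverings yields equality, so the density
  depends neither on the covering nor on the chosen preimage.\<close>

lemma universal_covering_density_le:
  assumes p: "holomorphic_universal_covering p G" and \<zeta>: "\<zeta> \<in> ball 0 1"
    and q: "holomorphic_universal_covering q G" and \<xi>: "\<xi> \<in> ball 0 1"
    and eq: "p \<zeta> = q \<xi>"
  shows "disk_density \<zeta> / cmod (deriv p \<zeta>) \<le> disk_density \<xi> / cmod (deriv q \<xi>)"
proof -
  have hol: "q holomorphic_on ball 0 1" and im: "q ` ball 0 1 = G"
    using q by (auto simp: holomorphic_universal_covering_def covering_space_imp_surjective)
  have \<xi>': "norm (-\<xi>) < 1" using \<xi> by simp
  define M where "M = Moebius_function 0 (-\<xi>)"
  have M0: "M 0 = \<xi>" by (simp add: M_def Moebius_function_of_zero)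
  have Mim: "M \<in> ball 0 1 \<rightarrow> ball 0 1"
    using Moebius_function_norm_lt_1[OF \<xi>'] by (auto simp: M_def)
  have "cmod (deriv (q \<circ> M) 0) * disk_density \<zeta> \<le> cmod (deriv p \<zeta>)"
  proof (rule deriv_le_of_universal_covering[OF p \<zeta>])
    show "(q \<circ> M) holomorphic_on ball 0 1"
      by (rule holomorphic_on_compose_gen[OF _ hol])
         (use Mim Moebius_function_holomorphic[OF \<xi>'] in \<open>auto simp: M_def\<close>)
  qed (use Mim im M0 eq in auto)
  moreover have "deriv (q \<circ> M) 0 = deriv q \<xi> * (1 - of_real ((cmod \<xi>)\<^sup>2))"
  proof (rule DERIV_imp_deriv, rule DERIV_chain)
    show "(q has_field_derivative deriv q \<xi>) (at (M 0))"
      using hol \<xi> M0 by (auto intro: holomorphic_derivI[where S = "ball 0 1"])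
    show "(M has_field_derivative 1 - of_real ((cmod \<xi>)\<^sup>2)) (at 0)"
      using Moebius_function_has_derivative[OF \<xi>', of 0] by (simp add: M_def)
  qed
  moreover have "cmod (1 - of_real ((cmod \<xi>)\<^sup>2)) = 1 / disk_density \<xi>"
  proof -
    have "1 - (cmod \<xi>)\<^sup>2 \<ge> 0" using \<xi> by (simp add: power_le_one_iff)
    then show ?thesis
      by (metis abs_of_nonneg disk_density_def div_by_1 divide_divide_eq_right mult_1 norm_of_real of_real_1 of_real_diff)
  qed
  ultimately have "cmod (deriv q \<xi>) / disk_density \<xi> * disk_density \<zeta> \<le> cmod (deriv p \<zeta>)"
    by (simp add: norm_mult)
  then show ?thesis
    using disk_density_pos[OF \<zeta>] disk_density_pos[OF \<xi>]
      universal_covering_deriv_nonzero[OF p \<zeta>] universal_covering_deriv_nonzero[OF q \<xi>]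
    by (simp add: field_simps)
qed

lemma hyperbolic_density_eq:
  assumes p: "holomorphic_universal_covering p G" and \<zeta>: "\<zeta> \<in> ball 0 1"
  shows "hyperbolic_density G (p \<zeta>) = disk_density \<zeta> / cmod (deriv p \<zeta>)"
  unfolding hyperbolic_density_def
proof (rule the_equality)
  \<comment> \<open>The defining equation must hold at every preimage of \<open>p \<zeta>\<close>;
    comparing \<open>p\<close> with itself in both directions provides this.\<close>
  have "disk_density \<zeta> / cmod (deriv p \<zeta>) * cmod (deriv p \<xi>) = disk_density \<xi>"
    if "\<xi> \<in> ball 0 1" "p \<xi> = p \<zeta>" for \<xi>
    using universal_covering_density_le[OF p \<zeta> p that(1)] universal_covering_density_le[OF p that(1) p \<zeta>]
      universal_covering_deriv_nonzero[OF p that(1)] that(2) by (simp add: field_simps)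
  then show "\<exists>p'. holomorphic_universal_covering p' G \<and> (\<forall>\<xi>\<in>ball 0 1. p' \<xi> = p \<zeta> \<longrightarrow>
      disk_density \<zeta> / cmod (deriv p \<zeta>) * cmod (deriv p' \<xi>) = disk_density \<xi>)"
    using p by blast
next
  fix r
  assume "\<exists>p'. holomorphic_universal_covering p' G \<and>
     (\<forall>\<xi>\<in>ball 0 1. p' \<xi> = p \<zeta> \<longrightarrow> r * cmod (deriv p' \<xi>) = disk_density \<xi>)"
  then obtain p' where p': "holomorphic_universal_covering p' G"
    and r: "\<And>\<xi>. \<xi> \<in> ball 0 1 \<Longrightarrow> p' \<xi> = p \<zeta> \<Longrightarrow> r * cmod (deriv p' \<xi>) = disk_density \<xi>"
    by blast
  have "p ` ball 0 1 = G" "p' ` ball 0 1 = G"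
    using p p' by (auto simp: holomorphic_universal_covering_def covering_space_imp_surjective)
  \<comment> \<open>Surjectivity of \<open>p'\<close> prevents its condition on \<open>r\<close>
    from holding vacuously.\<close>
  then obtain \<xi> where \<xi>: "\<xi> \<in> ball 0 1" "p' \<xi> = p \<zeta>"
    using \<zeta> by (metis image_iff)
  then have "r = disk_density \<xi> / cmod (deriv p' \<xi>)"
    using r[OF \<xi>] universal_covering_deriv_nonzero[OF p' \<xi>(1)] by (simp add: field_simps)
  then show "r = disk_density \<zeta> / cmod (deriv p \<zeta>)"
    using universal_covering_density_le[OF p \<zeta> p' \<xi>(1)] universal_covering_density_le[OF p' \<xi>(1) p \<zeta>] \<xi>
    by simp
qed

text \<open>The extremal property of the density: an upper bound requires only an explicit test map
  of the disk into \<open>G\<close>, not the covering itself.\<close>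

lemma hyperbolic_density_le:
  assumes p: "holomorphic_universal_covering p G"
    and f: "f holomorphic_on ball 0 1" "f \<in> ball 0 1 \<rightarrow> G" and nz: "deriv f 0 \<noteq> 0"
  shows "hyperbolic_density G (f 0) \<le> 1 / cmod (deriv f 0)"
proof -
  have "p ` ball 0 1 = G"
    using p by (auto simp: holomorphic_universal_covering_def covering_space_imp_surjective)
  then obtain \<zeta> where \<zeta>: "\<zeta> \<in> ball 0 1" "f 0 = p \<zeta>"
    using f(2) by (metis Pi_iff centre_in_ball image_iff zero_less_one)
  show ?thesis
    using deriv_le_of_universal_covering[OF p \<zeta>(1) f \<zeta>(2)] nz
      universal_covering_deriv_nonzero[OF p \<zeta>(1)]
    by (simp add: \<zeta>(2) hyperbolic_density_eq[OF p \<zeta>(1)] field_simps)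
qed

lemma hyperbolic_density_pos:
  assumes p: "holomorphic_universal_covering p G" and z: "z \<in> G"
  shows "hyperbolic_density G z > 0"
proof -
  have "p ` ball 0 1 = G"
    using p by (auto simp: holomorphic_universal_covering_def covering_space_imp_surjective)
  then obtain \<zeta> where \<zeta>: "\<zeta> \<in> ball 0 1" "z = p \<zeta>"
    using z by (metis image_iff)
  show ?thesis
    using disk_density_pos[OF \<zeta>(1)] universal_covering_deriv_nonzero[OF p \<zeta>(1)]
    by (simp add: \<zeta>(2) hyperbolic_density_eq[OF p \<zeta>(1)])
qed

subsection \<open>Coverings from local sections\<close>

text \<open>
  Evenness of the covering is recorded by holomorphic sections over balls. In contrast to a connected
  covering space, \<open>U\<close> is not assumed to be connected, so no component has to be selected when
  it is replaced by a preimage under a branched map.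
\<close>

definition has_ball_sections :: "complex set \<Rightarrow> (complex \<Rightarrow> complex) \<Rightarrow> complex set \<Rightarrow> bool" where
  "has_ball_sections U q G \<longleftrightarrow> q holomorphic_on U \<and> q \<in> U \<rightarrow> G \<and>
     (\<forall>w r \<zeta>. ball w r \<subseteq> G \<longrightarrow> \<zeta> \<in> U \<longrightarrow> q \<zeta> \<in> ball w r \<longrightarrow>
        (\<exists>g. g holomorphic_on ball w r \<and> g \<in> ball w r \<rightarrow> U \<and> g (q \<zeta>) = \<zeta> \<and>
             (\<forall>x\<in>ball w r. q (g x) = x)))"

lemma has_ball_sectionsE:
  assumes "has_ball_sections U q G" "ball w r \<subseteq> G" "\<zeta> \<in> U" "q \<zeta> \<in> ball w r"
  obtains g where "g holomorphic_on ball w r" "g \<in> ball w r \<rightarrow> U" "g (q \<zeta>) = \<zeta>"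
    "\<And>x. x \<in> ball w r \<Longrightarrow> q (g x) = x"
  using assms unfolding has_ball_sections_def by metis

lemma has_ball_sectionsI:
  assumes "q holomorphic_on U" "q \<in> U \<rightarrow> G"
    and "\<And>w r \<zeta>. ball w r \<subseteq> G \<Longrightarrow> \<zeta> \<in> U \<Longrightarrow> q \<zeta> \<in> ball w r \<Longrightarrow>
        \<exists>g. g holomorphic_on ball w r \<and> g \<in> ball w r \<rightarrow> U \<and> g (q \<zeta>) = \<zeta> \<and> (\<forall>x\<in>ball w r. q (g x) = x)"
  shows "has_ball_sections U q G"
  unfolding has_ball_sections_def by (intro conjI allI impI assms)

lemma holomorphic_sections_eq:
  assumes "connected B" "open B"
    and g: "g holomorphic_on B" "\<And>x. x \<in> B \<Longrightarrow> q (g x) = x"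
    and h: "h holomorphic_on B" "\<And>x. x \<in> B \<Longrightarrow> q (h x) = x"
    and a: "a \<in> B" "g a = h a" and x: "x \<in> B"
  shows "g x = h x"
proof -
  have "continuous_on B g" "continuous_on B h"
    using g h holomorphic_on_imp_continuous_on by auto
  have "open (g ` B)"
    using g by (intro open_mapping_thm3[OF g(1) \<open>open B\<close>] inj_on_inverseI[of _ q]) auto
  define E where "E = {x \<in> B. g x - h x = 0}"
  have "closedin (top_of_set B) E"
    unfolding E_def
    by (intro continuous_closedin_preimage_constant continuous_intros) fact+
  moreover have "E = B \<inter> h -` (g ` B)"
  proof
    show "E \<subseteq> B \<inter> h -` (g ` B)"
      by (force simp: E_def)
    show "B \<inter> h -` (g ` B) \<subseteq> E"
    proof
      fix x assume "x \<in> B \<inter> h -` (g ` B)"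
      then obtain y where y: "x \<in> B" "y \<in> B" "h x = g y" by auto
      then have "x = y" using g(2)[of y] h(2)[of x] by simp
      then show "x \<in> E" using y by (simp add: E_def)
    qed
  qed
  then have "openin (top_of_set B) E"
    using continuous_openin_preimage_gen[OF \<open>continuous_on B h\<close> \<open>open (g ` B)\<close>] by simp
  ultimately have "E = {} \<or> E = B"
    using \<open>connected B\<close> by (simp add: connected_clopen)
  then show ?thesis
    using a x by (auto simp: E_def)
qed

text \<open>A ball inside \<open>G\<close> that meets the image lies in it, since a section over the
  ball exhibits preimages. So the image and its complement in \<open>G\<close> are both open, and
  connectedness decides.\<close>

lemma has_ball_sections_image:
  assumes S: "has_ball_sections U q G" and G: "open G" "connected G" and "U \<noteq> {}"
  shows "q ` U = G"
proof -
  have im: "q ` U \<subseteq> G"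
    using S by (auto simp: has_ball_sections_def)
  have *: "ball w r \<subseteq> q ` U" if sub: "ball w r \<subseteq> G" and \<zeta>: "\<zeta> \<in> U" "q \<zeta> \<in> ball w r" for w r \<zeta>
  proof -
    obtain g where g: "g holomorphic_on ball w r" "g \<in> ball w r \<rightarrow> U" "g (q \<zeta>) = \<zeta>" "\<And>x. x \<in> ball w r \<Longrightarrow> q (g x) = x"
      by (rule has_ball_sectionsE[OF S sub \<zeta>]) (rule that)
    show ?thesis
    proof
      fix x assume "x \<in> ball w r"
      then have "x = q (g x)" "g x \<in> U" using g by auto
      then show "x \<in> q ` U" by (rule image_eqI)
    qed
  qed
  have "open (q ` U)"
  proof (rule openI)
    fix x assume x: "x \<in> q ` U"
    then obtain r where r: "r > 0" "ball x r \<subseteq> G"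
      using im G(1) by (meson openE subsetD)
    then have "ball x r \<subseteq> q ` U"
      using *[OF r(2)] x r(1) by fastforce
    then show "\<exists>e>0. ball x e \<subseteq> q ` U"
      using r by blast
  qed
  moreover have "open (G - q ` U)"
  proof (rule openI)
    fix x assume x: "x \<in> G - q ` U"
    then obtain r where r: "r > 0" "ball x r \<subseteq> G"
      using G(1) by (metis DiffD1 openE)
    have "ball x r \<inter> q ` U = {}"
    proof (rule ccontr)
      assume "ball x r \<inter> q ` U \<noteq> {}"
      then obtain \<zeta> where "\<zeta> \<in> U" "q \<zeta> \<in> ball x r" by blast
      then have "x \<in> q ` U" using *[OF r(2)] r(1) by (metis centre_in_ball subsetD)
      then show False using x by blast
    qed
    then show "\<exists>e>0. ball x e \<subseteq> G - q ` U"
      using r by blast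
  qed
  ultimately have "q ` U \<inter> G = {} \<or> (G - q ` U) \<inter> G = {}"
    by (intro connectedD[OF G(2)]) auto
  then show ?thesis
    using im \<open>U \<noteq> {}\<close> by blast
qed

text \<open>The sheets over a ball are the images of all sections over it. They are open by the open
  mapping theorem, and two sheets that meet coincide by uniqueness of sections.\<close>

lemma has_ball_sections_imp_covering_space:
  assumes S: "has_ball_sections U q G" and G: "open G" "connected G" and U: "U \<noteq> {}" "open U"
  shows "covering_space U q G"
proof
  have hol: "q holomorphic_on U"
    using S by (simp add: has_ball_sections_def)
  then show contq: "continuous_on U q"
    by (rule holomorphic_on_imp_continuous_on)
  show im: "q ` U = G"
    by (rule has_ball_sections_image) fact+
  fix x assume "x \<in> G"
  then obtain r where r: "r > 0" "ball x r \<subseteq> G"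
    using G(1) by (metis openE)
  define B where "B = ball x r"
  define sect where "sect g \<longleftrightarrow> g holomorphic_on B \<and> g \<in> B \<rightarrow> U \<and> (\<forall>x\<in>B. q (g x) = x)" for g
  have B: "connected B" "open B" "B \<subseteq> G" "x \<in> B"
    using r by (auto simp: B_def)
  define v where "v = {g ` B |g. sect g}"
  have "\<Union>v = U \<inter> q -` B"
  proof
    show "\<Union>v \<subseteq> U \<inter> q -` B"
      by (auto simp: v_def sect_def)
    show "U \<inter> q -` B \<subseteq> \<Union>v"
    proof
      fix \<zeta> assume \<zeta>: "\<zeta> \<in> U \<inter> q -` B"
      then have "\<zeta> \<in> U" "q \<zeta> \<in> ball x r" by (auto simp: B_def)
      then obtain g where "g holomorphic_on ball x r" "g \<in> ball x r \<rightarrow> U" "g (q \<zeta>) = \<zeta>"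
          "\<And>y. y \<in> ball x r \<Longrightarrow> q (g y) = y"
        using has_ball_sectionsE[OF S r(2)] by blast
      then have "sect g" "g (q \<zeta>) = \<zeta>" unfolding B_def sect_def by auto
      then show "\<zeta> \<in> \<Union>v"
        unfolding v_def using \<zeta> by (auto intro!: exI[of _ "g ` B"] image_eqI[of _ _ "q \<zeta>"])
    qed
  qed
  moreover have "openin (top_of_set U) u" if u: "u \<in> v" for u
  proof -
    obtain g where g: "sect g" "u = g ` B" using u by (auto simp: v_def)
    have "inj_on g B"
      by (rule inj_on_inverseI[of _ q]) (use g in \<open>auto simp: sect_def\<close>)
    then have "open (g ` B)"
      using g B by (intro open_mapping_thm3) (auto simp: sect_def)
    moreover have "u \<subseteq> U" using g by (auto simp: sect_def)
    ultimately show ?thesis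
      using g U by (simp add: openin_open_eq)
  qed
  moreover have "pairwise disjnt v"
  proof (rule pairwiseI)
    fix u u' assume "u \<in> v" "u' \<in> v" "u \<noteq> u'"
    then obtain g h where g: "sect g" "u = g ` B" and h: "sect h" "u' = h ` B"
      by (auto simp: v_def)
    show "disjnt u u'"
    proof (rule ccontr)
      assume "\<not> disjnt u u'"
      then obtain a b where ab: "a \<in> B" "b \<in> B" "g a = h b"
        using g h by (auto simp: disjnt_def)
      then have "a = b"
        using g(1) h(1) unfolding sect_def by metis
      have "g y = h y" if "y \<in> B" for y
        by (rule holomorphic_sections_eq[OF B(1,2), of g q h a])
           (use g h ab that \<open>a = b\<close> in \<open>auto simp: sect_def\<close>)
      then show False
        using \<open>u \<noteq> u'\<close> g h by auto
    qed
  qed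
  moreover have "\<exists>h. homeomorphism u B q h" if u: "u \<in> v" for u
  proof -
    obtain g where g: "sect g" "u = g ` B" using u by (auto simp: v_def)
    then have "u \<subseteq> U" by (auto simp: sect_def)
    then have "continuous_on u q"
      using contq continuous_on_subset by blast
    moreover have "continuous_on B g"
      using g by (auto simp: sect_def holomorphic_on_imp_continuous_on)
    ultimately have "homeomorphism u B q g"
      using g by (auto simp: homeomorphism_def sect_def image_image)
    then show ?thesis by blast
  qed
  ultimately show "\<exists>T. x \<in> T \<and> openin (top_of_set G) T \<and>
      (\<exists>v. \<Union>v = U \<inter> q -` T \<and> (\<forall>u\<in>v. openin (top_of_set U) u) \<and> pairwise disjnt v \<and>
           (\<forall>u\<in>v. \<exists>h. homeomorphism u T q h))"
    using B G(1) by (intro exI[of _ B] conjI exI[of _ v] ballI) (simp_all add: openin_open_eq)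
qed

subsection \<open>Uniformization of bounded domains\<close>

lemma has_ball_sections_Moebius:
  assumes S: "has_ball_sections U q G" and U: "U \<subseteq> ball 0 1" and w: "norm w < 1"
  shows "has_ball_sections {z \<in> ball 0 1. Moebius_function 0 w z \<in> U} (q \<circ> Moebius_function 0 w) G"
    (is "has_ball_sections ?V (q \<circ> ?M) G")
proof (rule has_ball_sectionsI)
  have holM: "?M holomorphic_on ball 0 1"
    by (rule Moebius_function_holomorphic[OF w])
  have hol: "q holomorphic_on U" and im: "q \<in> U \<rightarrow> G"
    using S by (auto simp: has_ball_sections_def)
  show "(q \<circ> ?M) holomorphic_on ?V"
    by (rule holomorphic_on_compose_gen[OF holomorphic_on_subset[OF holM] hol]) auto
  show "q \<circ> ?M \<in> ?V \<rightarrow> G"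
    using im by auto
  fix c r \<zeta> assume sub: "ball c r \<subseteq> G" and \<zeta>: "\<zeta> \<in> ?V" "(q \<circ> ?M) \<zeta> \<in> ball c r"
  have \<zeta>': "?M \<zeta> \<in> U" "q (?M \<zeta>) \<in> ball c r"
    using \<zeta> by auto
  obtain g where g: "g holomorphic_on ball c r" "g \<in> ball c r \<rightarrow> U" "g (q (?M \<zeta>)) = ?M \<zeta>"
    "\<And>x. x \<in> ball c r \<Longrightarrow> q (g x) = x"
    by (rule has_ball_sectionsE[OF S sub \<zeta>']) (rule that)
  \<comment> \<open>The inverse automorphism carries sections of \<open>q\<close> to sections of the
    composite.\<close>
  let ?N = "Moebius_function 0 (-w)"
  have w': "norm (-w) < 1" using w by simp
  have gim: "norm (g x) < 1" if "x \<in> ball c r" for x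
    using g(2) U that by (force simp: Pi_iff)
  have "(?N \<circ> g) holomorphic_on ball c r"
    by (rule holomorphic_on_compose_gen[OF g(1) Moebius_function_holomorphic[OF w']])
       (use gim in auto)
  moreover have "?M (?N (g x)) = g x" if "x \<in> ball c r" for x
    using Moebius_function_compose[of w "-w" "g x"] w gim[OF that] by simp
  moreover have "?N (?M \<zeta>) = \<zeta>"
    using Moebius_function_compose[of "-w" w \<zeta>] w \<zeta>(1) by simp
  moreover have "?N (g x) \<in> ball 0 1" if "x \<in> ball c r" for x
    using Moebius_function_norm_lt_1[OF w' gim[OF that]] by simp
  ultimately show "\<exists>h. h holomorphic_on ball c r \<and> h \<in> ball c r \<rightarrow> ?V \<and> h ((q \<circ> ?M) \<zeta>) = \<zeta> \<and>
      (\<forall>x\<in>ball c r. (q \<circ> ?M) (h x) = x)"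
    using g by (intro exI[of _ "?N \<circ> g"]) (auto simp: Pi_iff)
qed

text \<open>As \<open>0 \<notin> U\<close>, a section of \<open>q\<close> over a ball vanishes
  nowhere and has a holomorphic square root there. Both roots are sections of the pulled-back map;
  the sign decides which preimage is hit.\<close>

lemma has_ball_sections_square:
  assumes S: "has_ball_sections U q G" and U: "0 \<notin> U"
  shows "has_ball_sections {z. z\<^sup>2 \<in> U} (\<lambda>z. q (z\<^sup>2)) G"
proof (rule has_ball_sectionsI)
  have hol: "q holomorphic_on U" and im: "q \<in> U \<rightarrow> G"
    using S by (auto simp: has_ball_sections_def)
  have "(q \<circ> (\<lambda>z. z\<^sup>2)) holomorphic_on {z. z\<^sup>2 \<in> U}"
    by (rule holomorphic_on_compose_gen[OF _ hol]) (auto intro!: holomorphic_intros)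
  then show "(\<lambda>z. q (z\<^sup>2)) holomorphic_on {z. z\<^sup>2 \<in> U}"
    by (simp add: o_def)
  show "(\<lambda>z. q (z\<^sup>2)) \<in> {z. z\<^sup>2 \<in> U} \<rightarrow> G"
    using im by auto
  fix c r \<zeta> assume sub: "ball c r \<subseteq> G" and \<zeta>: "\<zeta> \<in> {z. z\<^sup>2 \<in> U}" "q (\<zeta>\<^sup>2) \<in> ball c r"
  have \<zeta>': "\<zeta>\<^sup>2 \<in> U" using \<zeta> by simp
  obtain g where g: "g holomorphic_on ball c r" "g \<in> ball c r \<rightarrow> U" "g (q (\<zeta>\<^sup>2)) = \<zeta>\<^sup>2"
    "\<And>x. x \<in> ball c r \<Longrightarrow> q (g x) = x"
    by (rule has_ball_sectionsE[OF S sub \<zeta>' \<zeta>(2)]) (rule that)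
  have "g x \<noteq> 0" if "x \<in> ball c r" for x
    using g(2) U that by (metis Pi_mem)
  then obtain h where h: "h holomorphic_on ball c r" "\<And>x. x \<in> ball c r \<Longrightarrow> g x = h x ^ 2"
    using contractible_imp_holomorphic_sqrt[OF g(1) convex_imp_contractible[OF convex_ball]] by metis
  have "h (q (\<zeta>\<^sup>2)) ^ 2 = \<zeta>\<^sup>2"
    using h(2)[OF \<zeta>(2)] g(3) by simp
  then have "h (q (\<zeta>\<^sup>2)) = \<zeta> \<or> h (q (\<zeta>\<^sup>2)) = - \<zeta>"
    by (rule power2_eq_iff[THEN iffD1])
  \<comment> \<open>\<open>s\<close> is 1 or -1 and selects the branch of the root that passes
    through \<zeta>.\<close>
  then obtain s where s: "s * h (q (\<zeta>\<^sup>2)) = \<zeta>" "s\<^sup>2 = 1"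
    by (metis minus_minus mult_1 mult_minus_left one_power2 power2_minus)
  show "\<exists>k. k holomorphic_on ball c r \<and> k \<in> ball c r \<rightarrow> {z. z\<^sup>2 \<in> U} \<and> k (q (\<zeta>\<^sup>2)) = \<zeta> \<and>
      (\<forall>x\<in>ball c r. q ((k x)\<^sup>2) = x)"
  proof (intro exI[of _ "\<lambda>x. s * h x"] conjI ballI Pi_I)
    show "(\<lambda>x. s * h x) holomorphic_on ball c r"
      by (intro holomorphic_intros h)
    have sq: "(s * h x)\<^sup>2 = g x" if "x \<in> ball c r" for x
      using h(2)[OF that] s(2) by (simp add: power_mult_distrib)
    show "q ((s * h x)\<^sup>2) = x" "s * h x \<in> {z. z\<^sup>2 \<in> U}" if "x \<in> ball c r" for x
      using sq[OF that] g(2,4) that by auto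
  qed (fact s)
qed

section \<open>Koebe's extremal problem\<close>

text \<open>These are the competitors in the minimisation of |q'(0)|. For a domain \<open>G\<close>,
  a competitor with \<open>U = ball 0 1\<close> is a universal covering normalised by
  \<open>q 0 = z0\<close>.\<close>

definition disk_approximation :: "complex set \<Rightarrow> complex \<Rightarrow> complex set \<Rightarrow> (complex \<Rightarrow> complex) \<Rightarrow> bool" where
  "disk_approximation G z0 U q \<longleftrightarrow>
     open U \<and> U \<subseteq> ball 0 1 \<and> 0 \<in> U \<and> q 0 = z0 \<and> has_ball_sections U q G"

lemma disk_approximation_exists:
  assumes "open G" "bounded G" "z0 \<in> G"
  shows "\<exists>U q. disk_approximation G z0 U q"
proof -
  obtain K where K: "K > 0" "\<And>z. z \<in> G \<Longrightarrow> norm z < K"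
    using \<open>bounded G\<close> bounded_pos_less by metis
  \<comment> \<open>Two points of \<open>G\<close> are less than 2K apart, so with this factor the
    preimage of \<open>G\<close> fits into the unit disk.\<close>
  define q where "q z = z0 + of_real (2 * K) * z" for z
  define U where "U = q -` G"
  have "open U"
    unfolding U_def q_def by (intro continuous_open_vimage \<open>open G\<close> continuous_intros)
  moreover have "U \<subseteq> ball 0 1"
  proof
    fix z assume "z \<in> U"
    then have "norm (q z) < K" "norm z0 < K"
      using K \<open>z0 \<in> G\<close> by (auto simp: U_def)
    then have "norm (of_real (2 * K) * z) < K + K"
      using norm_triangle_ineq4[of "q z" z0] by (simp add: q_def)
    then show "z \<in> ball 0 1"
      using K by (simp add: norm_mult)
  qed
  moreover have "has_ball_sections U q G"
  proof (rule has_ball_sectionsI)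
    show "q holomorphic_on U"
      unfolding q_def by (intro holomorphic_intros)
    show "q \<in> U \<rightarrow> G"
      by (auto simp: U_def)
    fix c r \<zeta> assume "ball c r \<subseteq> G"
    moreover have "q ((x - z0) / of_real (2 * K)) = x" "(q \<zeta> - z0) / of_real (2 * K) = \<zeta>" for x
      using K by (auto simp: q_def)
    ultimately show "\<exists>g. g holomorphic_on ball c r \<and> g \<in> ball c r \<rightarrow> U \<and> g (q \<zeta>) = \<zeta> \<and>
        (\<forall>x\<in>ball c r. q (g x) = x)"
      using K by (intro exI[of _ "\<lambda>x. (x - z0) / of_real (2 * K)"])
        (auto intro!: holomorphic_intros simp: U_def)
  qed
  moreover have "0 \<in> U" "q 0 = z0"
    using \<open>z0 \<in> G\<close> by (auto simp: U_def q_def)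
  ultimately show ?thesis
    unfolding disk_approximation_def by blast
qed

text \<open>A section over the ball, rescaled to the unit disk, is a self-map \<open>h\<close>
  fixing 0, and \<open>q \<circ> h\<close> is affine with slope \<open>r\<close>. Schwarz's lemma
  for \<open>h\<close> then bounds |q'(0)| from below, which keeps the infimum of the extremal
  problem positive.\<close>

lemma disk_approximation_deriv_ge:
  assumes A: "disk_approximation G z0 U q" and r: "r > 0" "ball z0 r \<subseteq> G"
  shows "r \<le> cmod (deriv q 0)"
proof -
  have U: "open U" "U \<subseteq> ball 0 1" "0 \<in> U" and q0: "q 0 = z0" and S: "has_ball_sections U q G"
    using A by (auto simp: disk_approximation_def)
  have q0': "q 0 \<in> ball z0 r" using q0 r by simp
  obtain g where g: "g holomorphic_on ball z0 r" "g \<in> ball z0 r \<rightarrow> U" "g (q 0) = 0"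
    "\<And>x. x \<in> ball z0 r \<Longrightarrow> q (g x) = x"
    by (rule has_ball_sectionsE[OF S r(2) U(3) q0']) (rule that)
  define h where "h x = g (z0 + of_real r * x)" for x
  have mem: "z0 + of_real r * x \<in> ball z0 r" if "norm x < 1" for x
    using that r by (simp add: dist_norm norm_mult)
  have "(g \<circ> (\<lambda>x. z0 + of_real r * x)) holomorphic_on ball 0 1"
    by (rule holomorphic_on_compose_gen[OF _ g(1)]) (use mem in \<open>auto intro!: holomorphic_intros\<close>)
  then have holh: "h holomorphic_on ball 0 1"
    by (simp add: h_def[abs_def] o_def)
  have lt1: "norm (h x) < 1" if "norm x < 1" for x
    using mem[OF that] g(2) U(2) unfolding h_def by (force simp: Pi_iff)
  have le: "norm (deriv h 0) \<le> 1"
    by (rule Schwarz_Lemma(2)[where \<xi> = 0, OF holh]) (use g(3) q0 lt1 in \<open>simp_all add: h_def\<close>)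
  have "q holomorphic_on U"
    using S by (auto simp: has_ball_sections_def)
  then have "(q has_field_derivative deriv q 0) (at (h 0))"
    using U g q0 by (auto intro: holomorphic_derivI[where S = U] simp: h_def)
  moreover have "(h has_field_derivative deriv h 0) (at 0)"
    using holh by (auto intro: holomorphic_derivI[where S = "ball 0 1"])
  ultimately have "(q \<circ> h has_field_derivative deriv q 0 * deriv h 0) (at 0)"
    by (rule DERIV_chain)
  moreover have "(q \<circ> h has_field_derivative of_real r) (at 0)"
  proof (rule DERIV_cong_ev[THEN iffD2, OF refl _ refl])
    show "((\<lambda>x. z0 + of_real r * x) has_field_derivative of_real r) (at 0)"
      by (auto intro!: derivative_eq_intros)
    show "\<forall>\<^sub>F x in nhds 0. (q \<circ> h) x = z0 + of_real r * x"
      by (rule eventually_nhds_in_open[of "ball 0 1", THEN eventually_mono])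
         (use mem g in \<open>auto simp: h_def\<close>)
  qed
  ultimately have "deriv q 0 * deriv h 0 = of_real r"
    by (rule DERIV_unique)
  then have "norm (deriv q 0) * norm (deriv h 0) = r"
    using r by (metis norm_mult norm_of_real abs_of_pos)
  then show ?thesis
    using mult_left_mono[OF le, of "norm (deriv q 0)"] by simp
qed

text \<open>
  Koebe's step: move \<open>a\<close> to 0 by a Moebius map, pull back along the squaring map, which branches only
  over the omitted point, and move a preimage of the old base point back to 0.
\<close>

lemma disk_approximation_improve:
  assumes A: "disk_approximation G z0 U q" and a: "norm a < 1" "a \<notin> U"
  shows "\<exists>V p. disk_approximation G z0 V p \<and>
           cmod (deriv p 0) = cmod (deriv q 0) * (2 * sqrt (cmod a) / (1 + cmod a))"
proof -
  have U: "open U" "U \<subseteq> ball 0 1" "0 \<in> U" and q0: "q 0 = z0" and S: "has_ball_sections U q G"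
    using A by (auto simp: disk_approximation_def)
  have a': "norm (-a) < 1" using a by simp
  \<comment> \<open>\<open>M\<close> takes -a to 0, so the base point 0 of \<open>U\<close>
    corresponds to -a in \<open>U1\<close> and to its square root \<open>b\<close> in
    \<open>U2\<close>; \<open>N\<close> takes 0 to \<open>b\<close>.\<close>
  define b where "b = csqrt (-a)"
  have b2: "b\<^sup>2 = -a" by (simp add: b_def)
  have nb: "norm b = sqrt (norm a)" by (simp add: b_def)
  have b: "norm (-b) < 1" using a nb by simp
  define M where "M = Moebius_function 0 (-a)"
  define N where "N = Moebius_function 0 (-b)"
  define U1 where "U1 = {z \<in> ball 0 1. M z \<in> U}"
  define U2 where "U2 = {z. z\<^sup>2 \<in> U1}"
  define U3 where "U3 = {z \<in> ball 0 1. N z \<in> U2}"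
  define p where "p = (\<lambda>z. (q \<circ> M) (z\<^sup>2)) \<circ> N"
  have M0: "M 0 = a" "M (-a) = 0" and N0: "N 0 = b"
    by (simp_all add: M_def N_def Moebius_function_of_zero Moebius_function_eq_zero)
  have S1: "has_ball_sections U1 (q \<circ> M) G"
    unfolding U1_def M_def by (rule has_ball_sections_Moebius[OF S U(2) a'])
  have "0 \<notin> U1"
    using a M0 by (simp add: U1_def)
  then have S2: "has_ball_sections U2 (\<lambda>z. (q \<circ> M) (z\<^sup>2)) G"
    unfolding U2_def by (rule has_ball_sections_square[OF S1])
  have "U2 \<subseteq> ball 0 1"
    by (auto simp: U2_def U1_def norm_power power_less_one_iff abs_square_less_1)
  then have S3: "has_ball_sections U3 p G"
    unfolding U3_def p_def N_def by (rule has_ball_sections_Moebius[OF S2 _ b])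
  have contM: "continuous_on (ball 0 1) M" and contN: "continuous_on (ball 0 1) N"
    unfolding M_def N_def
    by (intro holomorphic_on_imp_continuous_on Moebius_function_holomorphic a' b)+
  have "open (ball 0 1 \<inter> M -` U)"
    by (rule continuous_open_preimage[OF contM open_ball U(1)])
  then have "open U1"
    by (simp only: U1_def Collect_conj_eq vimage_def Collect_mem_eq)
  then have "open ((\<lambda>z. z\<^sup>2) -` U1)"
    by (intro continuous_open_vimage continuous_intros)
  then have "open U2"
    by (simp add: U2_def vimage_def)
  then have "open (ball 0 1 \<inter> N -` U2)"
    by (rule continuous_open_preimage[OF contN open_ball])
  then have "open U3"
    by (simp only: U3_def Collect_conj_eq vimage_def Collect_mem_eq)
  have "0 \<in> U3"
    using N0 b2 M0 a U by (simp add: U3_def U2_def U1_def)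
  have "p 0 = z0"
    using N0 b2 M0 q0 by (simp add: p_def)
  have dq: "(q has_field_derivative deriv q 0) (at (M (-a)))"
    using S U M0 by (auto intro: holomorphic_derivI[where S = U] simp: has_ball_sections_def)
  have na: "1 - (norm a)\<^sup>2 \<noteq> 0" "1 - (norm a)\<^sup>2 > 0"
    using a power_less_one_iff[of "norm a" 2] by auto
  have "(M has_field_derivative (1 - of_real ((cmod a)\<^sup>2)) / (1 - of_real ((cmod a)\<^sup>2))\<^sup>2) (at (b\<^sup>2))"
    using Moebius_function_has_derivative[OF a' a'] complex_norm_square[of a] unfolding b2
    by (simp add: M_def mult.commute)
  also have "(1 - of_real ((cmod a)\<^sup>2)) / (1 - of_real ((cmod a)\<^sup>2))\<^sup>2 = complex_of_real (1 / (1 - (cmod a)\<^sup>2))"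
  proof -
    have "x / x\<^sup>2 = 1 / x" for x :: complex by (simp add: power2_eq_square)
    then show ?thesis by simp
  qed
  finally have dM: "(M has_field_derivative complex_of_real (1 / (1 - (cmod a)\<^sup>2))) (at (b\<^sup>2))" .
  have dN: "(N has_field_derivative of_real (1 - cmod a)) (at 0)"
    using Moebius_function_has_derivative[OF b, of 0] nb by (simp add: N_def)
  have dsq: "((\<lambda>z. z\<^sup>2) has_field_derivative 2 * b) (at (N 0))"
    by (auto intro!: derivative_eq_intros simp: N0)
  have "(M \<circ> (\<lambda>z. z\<^sup>2) has_field_derivative of_real (1 / (1 - (cmod a)\<^sup>2)) * (2 * b)) (at (N 0))"
    by (rule DERIV_chain) (use dM dsq in \<open>simp_all add: N0\<close>)
  then have "((M \<circ> (\<lambda>z. z\<^sup>2)) \<circ> N has_field_derivative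
      of_real (1 / (1 - (cmod a)\<^sup>2)) * (2 * b) * of_real (1 - cmod a)) (at 0)"
    by (rule DERIV_chain) (rule dN)
  then have "(q \<circ> ((M \<circ> (\<lambda>z. z\<^sup>2)) \<circ> N) has_field_derivative
      deriv q 0 * (of_real (1 / (1 - (cmod a)\<^sup>2)) * (2 * b) * of_real (1 - cmod a))) (at 0)"
    by (rule DERIV_chain[rotated]) (use dq in \<open>simp add: N0 b2 M0\<close>)
  moreover have "q \<circ> ((M \<circ> (\<lambda>z. z\<^sup>2)) \<circ> N) = p"
    by (auto simp: p_def)
  ultimately have "deriv p 0 = deriv q 0 * (of_real (1 / (1 - (cmod a)\<^sup>2)) * (2 * b) * of_real (1 - cmod a))"
    using DERIV_imp_deriv by metis
  \<comment> \<open>The three factors come from \<open>M\<close> at -a, squaring at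
    \<open>b\<close>, and \<open>N\<close> at 0, where 1 - |b|^2 = 1 - |a|.\<close>
  then have "cmod (deriv p 0) = cmod (deriv q 0) *
      (\<bar>1 / (1 - (cmod a)\<^sup>2)\<bar> * (2 * sqrt (cmod a)) * \<bar>1 - cmod a\<bar>)"
    by (simp only: norm_mult norm_of_real nb norm_numeral)
  also have "\<bar>1 / (1 - (cmod a)\<^sup>2)\<bar> * (2 * sqrt (cmod a)) * \<bar>1 - cmod a\<bar> = 2 * sqrt (cmod a) / (1 + cmod a)"
  proof -
    have "(1 - cmod a) * (1 + cmod a) = 1 - (cmod a)\<^sup>2"
      by (simp add: algebra_simps power2_eq_square)
    moreover have "1 + cmod a > 0" "1 - cmod a > 0"
      using a by (auto simp: add_pos_nonneg)
    ultimately show ?thesis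
      using na by (simp add: field_simps)
  qed
  finally have "cmod (deriv p 0) = cmod (deriv q 0) * (2 * sqrt (cmod a) / (1 + cmod a))" .
  moreover have "disk_approximation G z0 U3 p"
    unfolding disk_approximation_def
    using \<open>open U3\<close> \<open>0 \<in> U3\<close> \<open>p 0 = z0\<close> S3 by (auto simp: U3_def)
  ultimately show ?thesis by blast
qed

text \<open>With s and t the square roots, the claim reduces to (t - s)(1 - st) \<ge> 0. It makes
  Koebe's factor for any omitted point of modulus below \<rho> at most the factor for modulus
  \<rho>.\<close>

lemma sqrt_over_one_plus_mono:
  fixes x y :: real
  assumes "0 \<le> x" "x \<le> y" "y \<le> 1"
  shows "2 * sqrt x / (1 + x) \<le> 2 * sqrt y / (1 + y)"
proof -
  define s t where "s = sqrt x" and "t = sqrt y"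
  have st: "0 \<le> s" "s \<le> t" "t \<le> 1" "x = s\<^sup>2" "y = t\<^sup>2"
    using assms by (auto simp: s_def t_def)
  have "s * t \<le> 1" using mult_le_one[of s t] st by linarith
  then have "0 \<le> (t - s) * (1 - s * t)" using st by simp
  then have "s * (1 + t\<^sup>2) \<le> t * (1 + s\<^sup>2)" by (simp add: algebra_simps power2_eq_square)
  moreover have "1 + s\<^sup>2 > 0" "1 + t\<^sup>2 > 0" by (auto simp: add_pos_nonneg)
  ultimately have "2 * s / (1 + s\<^sup>2) \<le> 2 * t / (1 + t\<^sup>2)"
    by (simp add: field_simps)
  then show ?thesis
    unfolding s_def[symmetric] t_def[symmetric] st(4,5)[symmetric] .
qed

text \<open>The infimum \<open>m\<close> of |q'(0)| is positive and Koebe's factor is at most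
  \<open>c < 1\<close> for every point of modulus below \<rho>. A competitor with |q'(0)| < m/c
  therefore omits no such point, since the improved one would fall below \<open>m\<close>.\<close>

lemma disk_approximation_exhausting:
  assumes G: "open G" "bounded G" "z0 \<in> G" and \<rho>: "0 < \<rho>" "\<rho> < 1"
  shows "\<exists>U q. disk_approximation G z0 U q \<and> ball 0 \<rho> \<subseteq> U"
proof -
  define D where "D = {cmod (deriv q 0) |U q. disk_approximation G z0 U q}"
  define m where "m = Inf D"
  define c where "c = 2 * sqrt \<rho> / (1 + \<rho>)"
  obtain r where r: "r > 0" "ball z0 r \<subseteq> G"
    using G by (meson openE)
  have ge_r: "r \<le> x" if "x \<in> D" for x
    using that disk_approximation_deriv_ge[OF _ r] by (auto simp: D_def)
  have "D \<noteq> {}"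
    using disk_approximation_exists[OF G] by (auto simp: D_def)
  have "bdd_below D"
    using ge_r by (rule bdd_belowI)
  have "m \<ge> r"
    unfolding m_def by (rule cInf_greatest) (use \<open>D \<noteq> {}\<close> ge_r in auto)
  have "c > 0"
    using \<rho> by (simp add: c_def)
  have "c < 1"
  proof -
    have "(1 - sqrt \<rho>)\<^sup>2 > 0" using \<rho> by simp
    then show ?thesis
      using \<rho> by (simp add: c_def power2_eq_square algebra_simps)
  qed
  then have "m < m / c"
    using \<open>m \<ge> r\<close> r \<open>c > 0\<close> by (simp add: field_simps)
  then obtain x where "x \<in> D" "x < m / c"
    unfolding m_def by (metis cInf_lessD \<open>D \<noteq> {}\<close>)
  then obtain U q where A: "disk_approximation G z0 U q" and lt: "cmod (deriv q 0) < m / c"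
    by (auto simp: D_def)
  have "ball 0 \<rho> \<subseteq> U"
  proof
    fix a :: complex assume a: "a \<in> ball 0 \<rho>"
    show "a \<in> U"
    proof (rule ccontr)
      assume "a \<notin> U"
      moreover have "norm a < 1" using a \<rho> by simp
      ultimately obtain V p where B: "disk_approximation G z0 V p"
        and eq: "cmod (deriv p 0) = cmod (deriv q 0) * (2 * sqrt (cmod a) / (1 + cmod a))"
        using disk_approximation_improve[OF A] by blast
      have "m \<le> cmod (deriv p 0)"
        unfolding m_def by (rule cInf_lower[OF _ \<open>bdd_below D\<close>]) (use B in \<open>auto simp: D_def\<close>)
      also have "\<dots> \<le> cmod (deriv q 0) * c"
        unfolding eq c_def using a \<rho> by (intro mult_left_mono sqrt_over_one_plus_mono) auto
      also have "\<dots> < m"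
        using lt \<open>c > 0\<close> by (simp add: field_simps)
      finally show False by simp
    qed
  qed
  then show ?thesis using A by blast
qed

section \<open>Normal families and the limiting covering\<close>

text \<open>Locally uniform convergence allows the argument to move with the index:
  \<open>f n (y n) - g (y n)\<close> is small uniformly on a closed ball about \<open>x\<close>, and
  \<open>g (y n)\<close> converges by continuity. This passes identities between composed maps to
  the limit.\<close>

lemma uniform_limit_diagonal:
  fixes f :: "nat \<Rightarrow> complex \<Rightarrow> complex"
  assumes S: "open S" "x \<in> S" and g: "continuous_on S g"
    and ul: "\<And>K. compact K \<Longrightarrow> K \<subseteq> S \<Longrightarrow> uniform_limit K f g sequentially"
    and y: "y \<longlonglongrightarrow> x"
  shows "(\<lambda>n. f n (y n)) \<longlonglongrightarrow> g x"
proof -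
  obtain e where e: "e > 0" "cball x e \<subseteq> S"
    using S open_contains_cball by blast
  have "\<forall>\<^sub>F n in sequentially. dist (y n) x < e"
    using y e(1) by (rule tendstoD)
  then have ev: "\<forall>\<^sub>F n in sequentially. y n \<in> cball x e"
    by eventually_elim (simp add: dist_commute)
  have ulK: "uniform_limit (cball x e) f g sequentially"
    by (rule ul) (use e in auto)
  have "(\<lambda>n. f n (y n) - g (y n)) \<longlonglongrightarrow> 0"
  proof (rule tendstoI)
    fix \<epsilon> :: real assume "\<epsilon> > 0"
    show "\<forall>\<^sub>F n in sequentially. dist (f n (y n) - g (y n)) 0 < \<epsilon>"
      using uniform_limitD[OF ulK \<open>\<epsilon> > 0\<close>] ev
      by eventually_elim (simp add: dist_norm)
  qed
  moreover have "isCont g x"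
    using g S continuous_on_eq_continuous_at by blast
  then have "(\<lambda>n. g (y n)) \<longlonglongrightarrow> g x"
    using y by (rule isCont_tendsto_compose)
  ultimately have "(\<lambda>n. (f n (y n) - g (y n)) + g (y n)) \<longlonglongrightarrow> 0 + g x"
    by (rule tendsto_add)
  then show ?thesis by simp
qed

text \<open>A limit of maps into the disk is a priori bounded only by 1. By the maximum principle,
  attaining modulus 1 would make it constant, against its value at \<open>a\<close>.\<close>

lemma holomorphic_into_ball:
  assumes g: "g holomorphic_on B" and B: "open B" "connected B"
    and le: "\<And>x. x \<in> B \<Longrightarrow> norm (g x) \<le> 1"
    and a: "a \<in> B" "norm (g a) < 1" and x: "x \<in> B"
  shows "norm (g x) < 1"
proof (rule ccontr)
  assume "\<not> norm (g x) < 1"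
  then have "norm (g x) = 1" using le[OF x] by simp
  then have "g constant_on B"
    using le by (intro maximum_modulus_principle[OF g B B(1) _ x]) auto
  then have "g a = g x"
    using a(1) x by (auto simp: constant_on_def)
  then show False
    using a(2) \<open>norm (g x) = 1\<close> by simp
qed

text \<open>Besides the covering maps, their local sections form normal families. Limits of sections
  are sections of the limit map, which is why the covering property survives.\<close>

lemma universal_covering_exists:
  assumes G: "open G" "connected G" "bounded G" "G \<noteq> {}"
  shows "\<exists>p. holomorphic_universal_covering p G"
proof -
  obtain z0 where "z0 \<in> G" using G by auto
  \<comment> \<open>The shift by 2 makes \<rho> positive already at index 0, where it equals
    1/2.\<close>
  define \<rho> where "\<rho> n = 1 - 1 / (real n + 2)" for n
  have \<rho>: "0 < \<rho> n" "\<rho> n < 1" for n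
    by (auto simp: \<rho>_def field_simps)
  have "\<rho> \<longlonglongrightarrow> 1"
    unfolding \<rho>_def by real_asymp
  have "\<forall>n. \<exists>U q. disk_approximation G z0 U q \<and> ball 0 (\<rho> n) \<subseteq> U"
    using disk_approximation_exhausting[OF G(1,3) \<open>z0 \<in> G\<close>] \<rho> by blast
  then obtain U q where A: "\<And>n. disk_approximation G z0 (U n) (q n)"
    and sub: "\<And>n. ball 0 (\<rho> n) \<subseteq> U n"
    by metis
  have U: "open (U n)" "U n \<subseteq> ball 0 1" "q n 0 = z0" and S: "has_ball_sections (U n) (q n) G" for n
    using A[of n] by (auto simp: disk_approximation_def)
  have holq: "q n holomorphic_on U n" and imq: "q n \<in> U n \<rightarrow> G" for n
    using S[of n] by (auto simp: has_ball_sections_def)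
  \<comment> \<open>The \<open>q n\<close> have varying domains; rescaling gives maps on the whole disk.\<close>
  define P where "P n \<zeta> = q n (of_real (\<rho> n) * \<zeta>)" for n \<zeta>
  have mem: "of_real (\<rho> n) * \<zeta> \<in> U n" if "\<zeta> \<in> ball 0 1" for n \<zeta>
  proof -
    have "of_real (\<rho> n) * \<zeta> \<in> ball 0 (\<rho> n)"
      using that \<rho>[of n] by (simp add: norm_mult)
    then show ?thesis using sub by blast
  qed
  have holP: "P n holomorphic_on ball 0 1" for n
  proof -
    have "(q n \<circ> (\<lambda>\<zeta>. of_real (\<rho> n) * \<zeta>)) holomorphic_on ball 0 1"
      by (rule holomorphic_on_compose_gen[OF _ holq[of n]]) (use mem in \<open>auto intro!: holomorphic_intros\<close>)
    then show ?thesis by (simp add: P_def[abs_def] o_def)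
  qed
  have imP: "P n \<zeta> \<in> G" if "\<zeta> \<in> ball 0 1" for n \<zeta>
    using mem[OF that] imq unfolding P_def by blast
  obtain K where K: "\<And>z. z \<in> G \<Longrightarrow> norm z \<le> K"
    using G(3) bounded_iff by metis
  define H where "H = {h. h holomorphic_on ball 0 1 \<and> (\<forall>z\<in>ball 0 1. norm (h z) \<le> K)}"
  obtain p r where holp: "p holomorphic_on ball 0 1" and r: "strict_mono (r :: nat \<Rightarrow> nat)"
    and lim: "\<And>x. x \<in> ball 0 1 \<Longrightarrow> (\<lambda>n. P (r n) x) \<longlonglongrightarrow> p x"
    and ul: "\<And>C. \<lbrakk>compact C; C \<subseteq> ball 0 1\<rbrakk> \<Longrightarrow> uniform_limit C (P \<circ> r) p sequentially"
  proof (rule Montel[of "ball 0 1" H P])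
    show "range P \<subseteq> H"
      using holP imP K by (auto simp: H_def)
    show "\<exists>B. \<forall>h\<in>H. \<forall>z\<in>C. norm (h z) \<le> B" if "C \<subseteq> ball 0 1" for C
      using that by (intro exI[of _ K]) (auto simp: H_def)
  qed (simp_all add: H_def)
  have contp: "continuous_on (ball 0 1) p"
    using holp by (rule holomorphic_on_imp_continuous_on)
  have sections: "\<exists>g. g holomorphic_on ball w s \<and> g \<in> ball w s \<rightarrow> ball 0 1 \<and> g (p \<zeta>) = \<zeta> \<and>
      (\<forall>x\<in>ball w s. p (g x) = x)"
    if B: "ball w s \<subseteq> G" and \<zeta>: "\<zeta> \<in> ball 0 1" "p \<zeta> \<in> ball w s" for w s \<zeta>
  proof -
    have "\<forall>\<^sub>F n in sequentially. P (r n) \<zeta> \<in> ball w s"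
      using lim[OF \<zeta>(1)] open_ball \<zeta>(2) by (rule topological_tendstoD)
    then obtain N where N: "\<And>n. n \<ge> N \<Longrightarrow> P (r n) \<zeta> \<in> ball w s"
      by (auto simp: eventually_sequentially)
    \<comment> \<open>From index \<open>N\<close> on, \<open>P (r n) \<zeta>\<close> lies in the
      ball, so there is a section through the rescaled point. Shifting by \<open>N\<close> gives a
      full sequence of sections.\<close>
    have "\<exists>g. g holomorphic_on ball w s \<and> g \<in> ball w s \<rightarrow> U (r (n + N)) \<and>
        g (P (r (n + N)) \<zeta>) = of_real (\<rho> (r (n + N))) * \<zeta> \<and>
        (\<forall>x\<in>ball w s. q (r (n + N)) (g x) = x)" for n
      using N[of "n + N"] mem[OF \<zeta>(1)] S[of "r (n + N)"] B
      unfolding P_def has_ball_sections_def by simp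
    then obtain g where holg: "\<And>n. g n holomorphic_on ball w s"
      and img: "\<And>n. g n \<in> ball w s \<rightarrow> U (r (n + N))"
      and g\<zeta>: "\<And>n. g n (P (r (n + N)) \<zeta>) = of_real (\<rho> (r (n + N))) * \<zeta>"
      and qg: "\<And>n x. x \<in> ball w s \<Longrightarrow> q (r (n + N)) (g n x) = x"
      by metis
    have g1: "norm (g n x) < 1" if "x \<in> ball w s" for n x
      using img[of n] U(2)[of "r (n + N)"] that by (force simp: Pi_iff)
    define F where "F = {h. h holomorphic_on ball w s \<and> (\<forall>z\<in>ball w s. norm (h z) \<le> 1)}"
    \<comment> \<open>The sections are already valued in the disk, so they form a normal family; strict bounds
      survive in the limit because \<open>h (p \<zeta>) = \<zeta>\<close> lies inside.\<close>
    obtain h t where holh: "h holomorphic_on ball w s" and t: "strict_mono (t :: nat \<Rightarrow> nat)"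
      and limh: "\<And>x. x \<in> ball w s \<Longrightarrow> (\<lambda>n. g (t n) x) \<longlonglongrightarrow> h x"
      and ulh: "\<And>C. \<lbrakk>compact C; C \<subseteq> ball w s\<rbrakk> \<Longrightarrow> uniform_limit C (g \<circ> t) h sequentially"
    proof (rule Montel[of "ball w s" F g])
      show "range g \<subseteq> F"
        using holg g1 by (auto simp: F_def less_imp_le)
      show "\<exists>B. \<forall>h\<in>F. \<forall>z\<in>C. norm (h z) \<le> B" if "C \<subseteq> ball w s" for C
        using that by (intro exI[of _ 1]) (auto simp: F_def)
    qed (simp_all add: F_def)
    define k where "k n = t n + N" for n
    have k: "strict_mono k"
      using t by (auto simp: k_def strict_mono_def)
    have fk: "filterlim k at_top sequentially"
      by (rule filterlim_subseq[OF k])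
    have lim\<zeta>: "(\<lambda>n. P (r (k n)) \<zeta>) \<longlonglongrightarrow> p \<zeta>"
      using filterlim_compose[OF lim[OF \<zeta>(1)] fk] by simp
    have \<rho>k: "(\<lambda>n. of_real (\<rho> (r (k n))) :: complex) \<longlonglongrightarrow> 1"
      using tendsto_of_real[OF filterlim_compose[OF filterlim_compose[OF \<open>\<rho> \<longlonglongrightarrow> 1\<close> filterlim_subseq[OF r]] fk],
          where 'a = complex] by simp
    \<comment> \<open>The same sequence is computed twice: as a diagonal limit, and through the
      normalisation of the sections, whose values are \<rho> times \<zeta> with \<rho> tending to
      1.\<close>
    have "(\<lambda>n. (g \<circ> t) n (P (r (k n)) \<zeta>)) \<longlonglongrightarrow> h (p \<zeta>)"
      by (rule uniform_limit_diagonal[OF open_ball \<zeta>(2) holomorphic_on_imp_continuous_on[OF holh] ulh lim\<zeta>])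
    moreover have "(\<lambda>n. (g \<circ> t) n (P (r (k n)) \<zeta>)) \<longlonglongrightarrow> 1 * \<zeta>"
      using tendsto_mult[OF \<rho>k tendsto_const[of \<zeta>]] by (simp add: k_def g\<zeta>)
    ultimately have h\<zeta>: "h (p \<zeta>) = \<zeta>"
      using LIMSEQ_unique by fastforce
    have h_le: "norm (h x) \<le> 1" if "x \<in> ball w s" for x
      by (rule Lim_norm_ubound[OF sequentially_bot limh[OF that]]) (intro always_eventually allI less_imp_le g1 that)
    have h1: "h x \<in> ball 0 1" if "x \<in> ball w s" for x
      using holomorphic_into_ball[OF holh open_ball connected_ball h_le \<zeta>(2) _ that] h\<zeta> \<zeta>(1) by simp
    have "p (h x) = x" if x: "x \<in> ball w s" for x
    proof -
      \<comment> \<open>Dividing by \<rho> undoes the rescaling in \<open>P\<close>, so that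
        \<open>P (r (k n)) (y n) = x\<close> for every \<open>n\<close>.\<close>
      define y where "y n = g (t n) x / of_real (\<rho> (r (k n)))" for n
      have "y \<longlonglongrightarrow> h x / 1"
        unfolding y_def by (intro tendsto_divide limh[OF x] \<rho>k) simp
      then have "y \<longlonglongrightarrow> h x" by simp
      moreover have "uniform_limit C (\<lambda>n. P (r (k n))) p sequentially"
        if "compact C" "C \<subseteq> ball 0 1" for C
        using filterlim_compose[OF ul[OF that] fk] by (simp add: o_def)
      ultimately have "(\<lambda>n. P (r (k n)) (y n)) \<longlonglongrightarrow> p (h x)"
        using uniform_limit_diagonal[OF open_ball h1[OF x] contp] by blast
      moreover have "P (r (k n)) (y n) = x" for n
        using \<rho>(1)[of "r (k n)"] qg[OF x, of "t n"] by (simp add: P_def y_def k_def)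
      ultimately show ?thesis
        by (simp add: LIMSEQ_const_iff)
    qed
    then show ?thesis
      using holh h1 h\<zeta> by blast
  qed
  have "p 0 = z0"
    using lim[of 0] U(3) by (simp add: P_def LIMSEQ_const_iff)
  obtain s where s: "s > 0" "ball z0 s \<subseteq> G"
    using G(1) \<open>z0 \<in> G\<close> by (meson openE)
  \<comment> \<open>Hurwitz's theorem below is applied to a nonconstant limit; sections over a ball
    about \<open>z0\<close> show that \<open>p\<close> attains every value there.\<close>
  have nonconst: "\<not> p constant_on ball 0 1"
  proof
    assume "p constant_on ball 0 1"
    then obtain c where c: "\<And>z. z \<in> ball 0 1 \<Longrightarrow> p z = c"
      by (auto simp: constant_on_def)
    obtain g where g: "g \<in> ball z0 s \<rightarrow> ball 0 1" "\<And>x. x \<in> ball z0 s \<Longrightarrow> p (g x) = x"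
      using sections[OF s(2), of 0] s \<open>p 0 = z0\<close> by auto
    then have "x = c" if "x \<in> ball z0 s" for x
      using c[of "g x"] that by (metis Pi_mem)
    from this[of z0] this[of "z0 + of_real (s / 2)"] show False
      using s(1) by (simp add: dist_norm)
  qed
  have "p \<zeta> \<in> G" if \<zeta>: "\<zeta> \<in> ball 0 1" for \<zeta>
  proof (rule ccontr)
    assume nG: "p \<zeta> \<notin> G"
    \<comment> \<open>If \<open>p \<zeta>\<close> lay outside \<open>G\<close>, the functions
      \<open>P (r n) - p \<zeta>\<close> would be zero-free, and by Hurwitz so would their limit,
      which vanishes at \<zeta>.\<close>
    have "p \<zeta> - p \<zeta> \<noteq> 0"
    proof (rule Hurwitz_no_zeros[of "ball 0 1" "\<lambda>n z. P (r n) z - p \<zeta>" "\<lambda>z. p z - p \<zeta>"])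
      show "(\<lambda>z. P (r n) z - p \<zeta>) holomorphic_on ball 0 1" for n
        by (intro holomorphic_intros holP)
      show "(\<lambda>z. p z - p \<zeta>) holomorphic_on ball 0 1"
        by (intro holomorphic_intros holp)
      show "uniform_limit C (\<lambda>n z. P (r n) z - p \<zeta>) (\<lambda>z. p z - p \<zeta>) sequentially"
        if "compact C" "C \<subseteq> ball 0 1" for C
        using ul[OF that] by (intro uniform_limit_intros) (simp add: o_def)
      show "\<not> (\<lambda>z. p z - p \<zeta>) constant_on ball 0 1"
        using nonconst by (auto simp: constant_on_def algebra_simps)
      show "P (r n) z - p \<zeta> \<noteq> 0" if "z \<in> ball 0 1" for n z
        using imP[OF that, of "r n"] nG by auto
    qed (use \<zeta> in auto)
    then show False by simp
  qed
  then have "has_ball_sections (ball 0 1) p G"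
    by (intro has_ball_sectionsI holp sections) auto
  then have "covering_space (ball 0 1) p G"
    by (rule has_ball_sections_imp_covering_space[OF _ G(1,2)]) auto
  then show ?thesis
    using holp by (auto simp: holomorphic_universal_covering_def)
qed

subsection \<open>Density estimates\<close>

text \<open>The right-hand side is the density of the punctured disk itself, and its covering serves
  as the test map into \<open>G\<close>. The logarithm is the gain over the order 1/|z - a|.\<close>

lemma hyperbolic_density_punctured_disk_le:
  assumes sub: "ball a s - {a} \<subseteq> G" and p: "holomorphic_universal_covering p G"
    and z: "z \<noteq> a" "norm (z - a) < s"
  shows "hyperbolic_density G z \<le> 1 / (2 * norm (z - a) * ln (s / norm (z - a)))"
proof -
  define d where "d = norm (z - a)"
  \<comment> \<open>Chosen so that \<open>s * exp (- L) = d\<close>, which places \<open>f 0\<close>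
    at \<open>z\<close>.\<close>
  define L where "L = ln (s / d)"
  have d: "0 < d" "d < s"
    using z by (auto simp: d_def)
  then have L: "L > 0"
    by (simp add: L_def)
  define u where "u = (z - a) / of_real d"
  have u: "norm u = 1" "of_real d * u = z - a"
    using d by (auto simp: u_def norm_divide d_def)
  \<comment> \<open>the universal covering of the punctured disk, normalized at \<open>z\<close>\<close>
  define f where "f \<zeta> = a + of_real s * u * exp (- of_real L * ((1 + \<zeta>) / (1 - \<zeta>)))" for \<zeta>
  have nz: "1 - \<zeta> \<noteq> 0" if "\<zeta> \<in> ball 0 1" for \<zeta> :: complex
    using that by auto
  have sexp: "s * exp (- L) = d"
    using d by (simp add: L_def exp_minus)
  have f0: "f 0 = z"
  proof -
    have "f 0 = a + of_real (s * exp (- L)) * u"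
      by (simp add: f_def exp_of_real[symmetric] mult_ac)
    then show ?thesis
      unfolding sexp u(2) by simp
  qed
  have "f holomorphic_on ball 0 1"
    unfolding f_def using nz by (auto intro!: holomorphic_intros)
  moreover have "f \<in> ball 0 1 \<rightarrow> G"
  proof
    fix \<zeta> :: complex assume \<zeta>: "\<zeta> \<in> ball 0 1"
    \<comment> \<open>The Cayley transform maps the disk into the right half-plane, so the
      exponential in \<open>f\<close> has modulus below 1.\<close>
    have Re_pos: "Re ((1 + \<zeta>) / (1 - \<zeta>)) > 0"
    proof -
      have "(Re \<zeta>)\<^sup>2 + (Im \<zeta>)\<^sup>2 < 1"
        using \<zeta> by (simp add: cmod_def)
      moreover have "(1 - Re \<zeta>)\<^sup>2 + (Im \<zeta>)\<^sup>2 > 0"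
        using nz[OF \<zeta>] by (auto simp: complex_eq_iff sum_power2_gt_zero_iff)
      ultimately show ?thesis
        by (simp add: Re_divide power2_eq_square algebra_simps)
    qed
    have "Re (- of_real L * w) = - L * Re w" for w
      by simp
    also have "- L * Re ((1 + \<zeta>) / (1 - \<zeta>)) < 0"
      using mult_pos_pos[OF L Re_pos] by linarith
    finally have "Re (- of_real L * ((1 + \<zeta>) / (1 - \<zeta>))) < 0" .
    then have "norm (exp (- of_real L * ((1 + \<zeta>) / (1 - \<zeta>)))) < 1"
      unfolding norm_exp_eq_Re by simp
    then have "norm (f \<zeta> - a) < s"
      using d u by (simp add: f_def norm_mult)
    moreover have "f \<zeta> \<noteq> a"
      using d u by (auto simp: f_def)
    ultimately have "f \<zeta> \<in> ball a s - {a}"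
      by (simp add: dist_norm norm_minus_commute)
    then show "f \<zeta> \<in> G"
      using sub by blast
  qed
  moreover have "(f has_field_derivative
      of_real s * u * (exp (- of_real L) * (- of_real L * 2))) (at 0)"
    unfolding f_def by (auto intro!: derivative_eq_intros)
  then have "norm (deriv f 0) = s * exp (- L) * 2 * L"
    using d u L by (simp add: DERIV_imp_deriv norm_mult norm_exp_eq_Re)
  then have df: "norm (deriv f 0) = 2 * d * L"
    unfolding sexp by simp
  ultimately have "hyperbolic_density G (f 0) \<le> 1 / norm (deriv f 0)"
    using d L by (intro hyperbolic_density_le[OF p]) auto
  then show ?thesis
    unfolding df f0 d_def L_def .
qed

text \<open>Recentre the covering so that 0 goes to 0, then send -d, 0, d affinely to 0, 1/2, 1. The
  result omits 0 and 1 and has the fixed value 1/2 at 0, so Landau's theorem bounds its derivative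
  there.\<close>

lemma hyperbolic_density_omitting_two_points_ge:
  "\<exists>C>0. \<forall>G p d. holomorphic_universal_covering p G \<longrightarrow> 0 \<in> G \<longrightarrow> d > 0 \<longrightarrow>
      of_real d \<notin> G \<longrightarrow> - of_real d \<notin> G \<longrightarrow> hyperbolic_density G 0 \<ge> C / d"
proof (rule Landau_Picard)
  fix R :: "complex \<Rightarrow> real"
  assume R: "\<And>z. 0 < R z"
    and Landau: "\<And>f. \<lbrakk>f holomorphic_on cball 0 (R (f 0));
       \<And>z. norm z \<le> R (f 0) \<Longrightarrow> f z \<noteq> 0 \<and> f z \<noteq> 1\<rbrakk> \<Longrightarrow> norm (deriv f 0) < 1"
  \<comment> \<open>Landau's radius depends only on the value at 0, which is always 1/2 here; hence
    the constant is uniform in \<open>G\<close>, \<open>p\<close> and \<open>d\<close>.\<close>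
  define r where "r = R (1 / 2)"
  have "r > 0" using R by (simp add: r_def)
  show ?thesis
  proof (intro exI[of _ "1 / (4 * r)"] conjI allI impI)
    show "1 / (4 * r) > 0" using \<open>r > 0\<close> by simp
    fix G p and d :: real
    assume p: "holomorphic_universal_covering p G" and G: "0 \<in> G" and d: "d > 0"
      and omit: "of_real d \<notin> G" "- of_real d \<notin> G"
    have hol: "p holomorphic_on ball 0 1" and im: "p ` ball 0 1 = G"
      using p by (auto simp: holomorphic_universal_covering_def covering_space_imp_surjective)
    obtain \<zeta> where \<zeta>: "\<zeta> \<in> ball 0 1" "p \<zeta> = 0"
      using G im by (metis image_iff)
    have \<zeta>': "norm (-\<zeta>) < 1" using \<zeta> by simp
    define M where "M = Moebius_function 0 (-\<zeta>)"
    have M0: "M 0 = \<zeta>" by (simp add: M_def Moebius_function_of_zero)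
    have holM: "M holomorphic_on ball 0 1"
      unfolding M_def by (rule Moebius_function_holomorphic[OF \<zeta>'])
    have Mim: "M z \<in> ball 0 1" if "z \<in> ball 0 1" for z
      using Moebius_function_norm_lt_1[OF \<zeta>', of z] that by (simp add: M_def)
    \<comment> \<open>Division by 2r maps the closed disk of radius \<open>r\<close> into the open
      unit disk. Together with the affine factor 2d it produces the 4rd below.\<close>
    define f where "f z = (p (M (z / of_real (2 * r))) + of_real d) / of_real (2 * d)" for z
    have mem: "z / of_real (2 * r) \<in> ball 0 1" if "norm z \<le> r" for z :: complex
      using that \<open>r > 0\<close> by (simp add: norm_divide field_simps)
    have "f 0 = 1 / 2"
      using M0 \<zeta> d by (simp add: f_def)
    have "norm (deriv f 0) < 1"
    proof (rule Landau)
      have "(p \<circ> (M \<circ> (\<lambda>z. z / of_real (2 * r)))) holomorphic_on cball 0 r"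
        by (rule holomorphic_on_compose_gen[OF holomorphic_on_compose_gen[OF _ holM] hol])
          (use mem Mim \<open>r > 0\<close> in \<open>auto intro!: holomorphic_intros\<close>)
      then show "f holomorphic_on cball 0 (R (f 0))"
        unfolding f_def[abs_def] \<open>f 0 = 1 / 2\<close>[unfolded f_def] r_def[symmetric]
        using d by (auto intro!: holomorphic_intros simp: o_def)
      fix z :: complex assume "norm z \<le> R (f 0)"
      then have "p (M (z / of_real (2 * r))) \<in> G"
        using Mim[OF mem[of z]] im \<open>f 0 = 1 / 2\<close> r_def by auto
      then have "p (M (z / of_real (2 * r))) \<noteq> of_real d" "p (M (z / of_real (2 * r))) \<noteq> - of_real d"
        using omit by auto
      then show "f z \<noteq> 0 \<and> f z \<noteq> 1"
        using d by (auto simp: f_def field_simps add_eq_0_iff2)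
    qed
    moreover have "norm (deriv f 0) = norm (deriv p \<zeta>) / disk_density \<zeta> / (4 * r * d)"
    proof -
      have "(p has_field_derivative deriv p \<zeta>) (at \<zeta>)"
        using hol \<zeta> by (auto intro: holomorphic_derivI[where S = "ball 0 1"])
      moreover have dM: "(M has_field_derivative of_real (1 - (cmod \<zeta>)\<^sup>2)) (at 0)"
        using Moebius_function_has_derivative[OF \<zeta>', of 0] by (simp add: M_def)
      moreover have "((\<lambda>z. z / of_real (2 * r)) has_field_derivative 1 / of_real (2 * r)) (at 0)"
        by (intro DERIV_cdivide DERIV_ident)
      ultimately have "(p \<circ> (M \<circ> (\<lambda>z. z / of_real (2 * r))) has_field_derivative
          deriv p \<zeta> * (of_real (1 - (cmod \<zeta>)\<^sup>2) * (1 / of_real (2 * r)))) (at 0)"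
        by (intro DERIV_chain) (simp_all only: o_def div_0 M0)
      then have "((\<lambda>z. (p (M (z / of_real (2 * r))) + of_real d) / of_real (2 * d)) has_field_derivative
          (deriv p \<zeta> * (of_real (1 - (cmod \<zeta>)\<^sup>2) * (1 / of_real (2 * r))) + 0) / of_real (2 * d)) (at 0)"
        unfolding o_def by (intro DERIV_cdivide DERIV_add DERIV_const)
      then have "deriv f 0 = deriv p \<zeta> * of_real ((1 - (cmod \<zeta>)\<^sup>2) / (4 * r * d))"
        unfolding f_def[abs_def] by (subst DERIV_imp_deriv) (auto simp: field_simps)
      then have "norm (deriv f 0) = norm (deriv p \<zeta>) * \<bar>(1 - (cmod \<zeta>)\<^sup>2) / (4 * r * d)\<bar>"
        by (simp only: norm_mult norm_of_real)
      moreover have "1 - (cmod \<zeta>)\<^sup>2 = 1 / disk_density \<zeta>"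
        by (simp add: disk_density_def)
      ultimately show ?thesis
        using disk_density_pos[OF \<zeta>(1)] \<open>r > 0\<close> d by simp
    qed
    ultimately have "norm (deriv p \<zeta>) / disk_density \<zeta> < 4 * r * d"
      using \<open>r > 0\<close> d disk_density_pos[OF \<zeta>(1)] by (simp add: field_simps)
    then have "norm (deriv p \<zeta>) \<le> 4 * r * d * disk_density \<zeta>"
      using disk_density_pos[OF \<zeta>(1)] by (simp add: field_simps)
    then have "disk_density \<zeta> / (4 * r * d * disk_density \<zeta>) \<le> disk_density \<zeta> / norm (deriv p \<zeta>)"
      using disk_density_pos[OF \<zeta>(1)] universal_covering_deriv_nonzero[OF p \<zeta>(1)]
      by (intro frac_le) auto
    then show "1 / (4 * r) / d \<le> hyperbolic_density G 0"
      using hyperbolic_density_eq[OF p \<zeta>(1)] \<zeta>(2) disk_density_pos[OF \<zeta>(1)] by simp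
  qed
qed

lemma ball_minus_finite_in_hyperbolic_domains:
  assumes "finite F" "\<rho> > 0" "\<rho> \<le> R" and ne: "ball 0 \<rho> - F \<noteq> {}"
  shows "ball 0 \<rho> - F \<in> hyperbolic_domains_in R"
    and "\<exists>p. holomorphic_universal_covering p (ball 0 \<rho> - F)"
proof -
  have op: "open (ball 0 \<rho> - F)"
    using \<open>finite F\<close> by (simp add: finite_imp_closed open_Diff)
  have con: "connected (ball 0 \<rho> - F)"
    by (rule connected_open_delete_finite) (use \<open>finite F\<close> in auto)
  \<comment> \<open>These boundary points serve as the two omitted points that hyperbolicity asks
    for.\<close>
  have "complex_of_real \<rho> \<notin> ball 0 \<rho>" "- complex_of_real \<rho> \<notin> ball 0 \<rho>"
    "complex_of_real \<rho> \<noteq> - complex_of_real \<rho>"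
    using \<open>\<rho> > 0\<close> by (auto simp: complex_eq_iff)
  then have "hyperbolic_domain (ball 0 \<rho> - F)"
    using op con ne unfolding hyperbolic_domain_def by blast
  then show "ball 0 \<rho> - F \<in> hyperbolic_domains_in R"
    using \<open>\<rho> \<le> R\<close> by (auto simp: hyperbolic_domains_in_def)
  show "\<exists>p. holomorphic_universal_covering p (ball 0 \<rho> - F)"
    by (rule universal_covering_exists) (use op con ne in \<open>auto intro: bounded_subset[OF bounded_ball]\<close>)
qed

section \<open>Divergence of the quotient at the midpoint of two punctures\<close>

theorem theorem1p2:
  fixes R :: real
  assumes "R > 0"
  shows "A_gen R = \<infinity>"
proof -
  obtain C where C: "C > 0" and ge:
    "\<And>G p d. holomorphic_universal_covering p G \<Longrightarrow> 0 \<in> G \<Longrightarrow> d > 0 \<Longrightarrow>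
        of_real d \<notin> G \<Longrightarrow> - of_real d \<notin> G \<Longrightarrow> hyperbolic_density G 0 \<ge> C / d"
    using hyperbolic_density_omitting_two_points_ge by metis
  have le_A: "ereal (C * L) \<le> A_gen R" if "L > 0" for L
  proof -
    \<comment> \<open>As \<open>d < R / 2\<close>, the disk of radius R/2 about either puncture
      stays inside \<open>ball 0 R\<close>. The logarithm in the punctured disk estimate with this
      radius is then exactly \<open>L\<close>.\<close>
    define d where "d = R / 2 * exp (- L)"
    have d: "0 < d" "d < R / 2"
      using \<open>R > 0\<close> \<open>L > 0\<close> by (auto simp: d_def)
    define D :: "real \<Rightarrow> complex set" where "D e = ball 0 R - {of_real e}" for e
    define E :: "complex set" where "E = ball 0 R - {of_real d, - of_real d}"
    have 0: "0 \<in> D d" "0 \<in> D (- d)" "0 \<in> E"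
      using d \<open>R > 0\<close> by (auto simp: D_def E_def)
    have D: "D e \<in> hyperbolic_domains_in R" "\<exists>p. holomorphic_universal_covering p (D e)"
      if "e \<in> {d, - d}" for e
    proof -
      have "ball 0 R - {of_real e} \<noteq> ({} :: complex set)"
        using that 0 unfolding D_def by blast
      from ball_minus_finite_in_hyperbolic_domains[OF _ \<open>R > 0\<close> order_refl this]
      show "D e \<in> hyperbolic_domains_in R" "\<exists>p. holomorphic_universal_covering p (D e)"
        unfolding D_def by simp_all
    qed
    have "E \<noteq> {}"
      using 0 by blast
    then obtain pE where pE: "holomorphic_universal_covering pE E"
      using ball_minus_finite_in_hyperbolic_domains(2)[of "{of_real d, - of_real d}" R R] \<open>R > 0\<close>
      unfolding E_def by auto
    have density_D: "0 < hyperbolic_density (D e) 0" "hyperbolic_density (D e) 0 \<le> 1 / (2 * d * L)"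
      if e: "e \<in> {d, - d}" for e
    proof -
      obtain p where p: "holomorphic_universal_covering p (D e)"
        using D(2)[OF e] by blast
      show "0 < hyperbolic_density (D e) 0"
        using hyperbolic_density_pos[OF p] 0 e by auto
      have abs_e: "\<bar>e\<bar> = d" using d e by auto
      have "hyperbolic_density (D e) 0 \<le>
          1 / (2 * norm (0 - of_real e :: complex) * ln (R / 2 / norm (0 - of_real e :: complex)))"
      proof (rule hyperbolic_density_punctured_disk_le[OF _ p])
        show "ball (of_real e) (R / 2) - {of_real e} \<subseteq> D e"
        proof
          fix z assume z: "z \<in> ball (of_real e) (R / 2) - {complex_of_real e}"
          then have "norm (z - of_real e) < R / 2"
            by (simp add: dist_norm norm_minus_commute)
          then have "norm z < R"
            using norm_triangle_ineq[of "z - of_real e" "of_real e"] abs_e d by simp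
          then show "z \<in> D e"
            using z by (simp add: D_def)
        qed
      qed (use d abs_e in auto)
      also have "R / 2 / d = exp L"
        using \<open>R > 0\<close> by (simp add: d_def exp_minus field_simps)
      then have "ln (R / 2 / norm (0 - of_real e :: complex)) = L"
        by (simp add: abs_e)
      finally show "hyperbolic_density (D e) 0 \<le> 1 / (2 * d * L)"
        by (simp add: abs_e)
    qed
    have "D d \<inter> D (- d) = E"
      by (auto simp: D_def E_def)
    moreover have "connected E"
      unfolding E_def by (rule connected_open_delete_finite) auto
    \<comment> \<open>Removing two points does not disconnect the disk, so the component in
      \<open>Q\<close> is the whole intersection.\<close>
    ultimately have "connected_component_set (D d \<inter> D (- d)) 0 = E"
      using 0 by (simp add: connected_component_eq_self)
    then have Q_eq: "Q (D d) (D (- d)) 0 =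
        hyperbolic_density E 0 / (hyperbolic_density (D d) 0 + hyperbolic_density (D (- d)) 0)"
      by (simp add: Q_def)
    \<comment> \<open>The distance \<open>d\<close> cancels, leaving only the logarithmic gain
      \<open>L\<close>.\<close>
    have "C * L = (C / d) / (1 / (2 * d * L) + 1 / (2 * d * L))"
      using d \<open>L > 0\<close> by (simp add: field_simps)
    also have "\<dots> \<le> Q (D d) (D (- d)) 0"
      unfolding Q_eq
    proof (rule frac_le)
      show "C / d \<le> hyperbolic_density E 0"
        by (rule ge[OF pE]) (use 0 d in \<open>auto simp: E_def\<close>)
      then show "0 \<le> hyperbolic_density E 0"
        using C d by (meson divide_pos_pos less_imp_le order_trans)
      show "0 < hyperbolic_density (D d) 0 + hyperbolic_density (D (- d)) 0"
        using density_D(1) by (simp add: add_pos_pos)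
      show "hyperbolic_density (D d) 0 + hyperbolic_density (D (- d)) 0 \<le> 1 / (2 * d * L) + 1 / (2 * d * L)"
        by (intro add_mono density_D) simp_all
    qed
    finally have "ereal (C * L) \<le> ereal (Q (D d) (D (- d)) 0)"
      by simp
    also have "\<dots> \<le> A_gen R"
      unfolding A_gen_def by (rule Sup_upper) (use D 0 in blast)
    finally show ?thesis .
  qed
  show ?thesis
  proof (rule ereal_top)
    fix B :: real
    \<comment> \<open>The summand 1 keeps the chosen \<open>L\<close> positive even when
      \<open>B = 0\<close>.\<close>
    have "ereal B \<le> ereal (C * ((\<bar>B\<bar> + 1) / C))"
      using C by simp
    also have "\<dots> \<le> A_gen R"
      by (rule le_A) (use C in \<open>simp add: add_nonneg_pos\<close>)
    finally show "ereal B \<le> A_gen R" .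
  qed
qed

end
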